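(* Let $\lambda>0$, $p,q\in[1,\infty]$. For any $\mathbf{Z},\mathbf{X}\in\mathbb{R}^{m\times n}$, $$\|\mathbf{Z}\|_{F_p} + \frac{\lambda}{\delta_{mn}(2,p)}\|\mathbf{X}\|_{F_2}\leq \max_{\boldsymbol\Delta\in\mathcal{U}_{\sigma_q}} \|\mathbf{Z}+\boldsymbol\Delta(\mathbf{X})\|_{F_p}\leq \|\mathbf{Z}\|_{F_p} + \lambda\,\delta_{mn}(p,2)\|\mathbf{X}\|_{F_2}.$$ In particular, if $p\notin\{1,2,\infty\}$ and $mn\ge2$, then for all $\mathbf{X}\neq\mathbf{0}$ the upper bound (second inequality) is strict for almost all $\mathbf{Z}$. Further, if $p\notin\{1,2,\infty\}$, the gap in the lower bound (first inequality) is arbitrarily small for all $\mathbf{X}$; that is, for every $\mathbf{X}$ the infimum over $\mathbf{Z}\in\mathbb{R}^{m\times n}$ of the middle expression minus the left expression equals $0$.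
   Context: For a matrix $\mathbf{A}$, $\|\mathbf{A}\|_{F_p}$ is the entrywise $\ell_p$ norm ($\max_{ij}|A_{ij}|$ if $p=\infty$). $\mathcal{U}_{\sigma_q}$ is the set of linear maps $\boldsymbol\Delta:\mathbb{R}^{m\times n}\to\mathbb{R}^{m\times n}$ with $\|\boldsymbol\Delta\|_{\sigma_q}\le\lambda$, where $\|\boldsymbol\Delta\|_{\sigma_q}$ is the Schatten norm ($\ell_q$ norm of the vector of singular values) of the $mn\times mn$ matrix representing $\boldsymbol\Delta$ in the standard basis of $\mathbb{R}^{m\times n}$. For $k\ge1$ and $a,b\in[1,\infty]$, $\delta_k(a,b):=\max\{\|\mathbf{u}\|_a:\mathbf{u}\in\mathbb{R}^k,\ \|\mathbf{u}\|_b=1\}$. "Almost all" is with respect to Lebesgue measure on $\mathbb{R}^{m\times n}$. *)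

theory Defs
  imports "HOL-Analysis.Analysis"
begin

definition lp_norm :: "ereal \<Rightarrow> 'i set \<Rightarrow> ('i \<Rightarrow> real) \<Rightarrow> real" where
  "lp_norm p I f =
    (if p = \<infinity> then Max ((\<lambda>i. \<bar>f i\<bar>) ` I)
     else (\<Sum>i\<in>I. \<bar>f i\<bar> powr real_of_ereal p) powr (1 / real_of_ereal p))"

definition entrywise_norm :: "ereal \<Rightarrow> real^'n^'m \<Rightarrow> real" where
  "entrywise_norm p A = lp_norm p UNIV (\<lambda>(i, j). A $ i $ j)"

text \<open>Vectors of length \<open>k\<close> are functions on \<open>nat\<close>, of which only the values below \<open>k\<close> matter.
  \<open>Greatest\<close> is a genuine maximum: it is unspecified if no maximum exists.\<close>

definition delta :: "nat \<Rightarrow> ereal \<Rightarrow> ereal \<Rightarrow> real" where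
  "delta k a b = (GREATEST v. \<exists>u :: nat \<Rightarrow> real. lp_norm b {..<k} u = 1 \<and> v = lp_norm a {..<k} u)"

text \<open>The singular values of \<open>A\<close> are the numbers \<open>s \<ge> 0\<close> such that \<open>s\<^sup>2\<close> is an eigenvalue of
  \<open>transpose A ** A\<close>.  They are listed with multiplicity: \<open>s\<close> occurs as \<open>(s, i)\<close> for each \<open>i\<close> below
  the dimension of the eigenspace (and so not at all if \<open>s\<^sup>2\<close> is not an eigenvalue).  As
  \<open>transpose A ** A\<close> is symmetric, geometric and algebraic multiplicity agree.\<close>

definition singular_values :: "real^'k^'k \<Rightarrow> (real \<times> nat) set" where
  "singular_values A =
    (SIGMA s:{0..}. {..<dim {x. (transpose A ** A) *v x = s\<^sup>2 *\<^sub>R x}})"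

definition schatten_norm :: "ereal \<Rightarrow> real^'k^'k \<Rightarrow> real" where
  "schatten_norm q A = lp_norm q (singular_values A) fst"

text \<open>The standard basis of the space of matrices consists of the matrix units
  \<open>axis i (axis j 1)\<close>, indexed by the pairs \<open>(i, j)\<close>.\<close>

definition rep_matrix :: "(real^'n^'m \<Rightarrow> real^'n^'m) \<Rightarrow> real^('m \<times> 'n)^('m \<times> 'n)" where
  "rep_matrix D = (\<chi> r c. D (axis (fst c) (axis (snd c) 1)) $ fst r $ snd r)"

definition uncertainty_set :: "ereal \<Rightarrow> real \<Rightarrow> (real^'n^'m \<Rightarrow> real^'n^'m) set" where
  "uncertainty_set q lam = {D. linear D \<and> schatten_norm q (rep_matrix D) \<le> lam}"

definition worst_case :: "ereal \<Rightarrow> ereal \<Rightarrow> real \<Rightarrow> real^'n^'m \<Rightarrow> real^'n^'m \<Rightarrow> real" where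
  "worst_case p q lam Z X =
    (GREATEST v. \<exists>D\<in>uncertainty_set q lam. v = entrywise_norm p (Z + D X))"

end

theory Submission imports Defs
begin

text \<open>By the spectral theorem the Schatten norm dominates the operator norm, and the two agree on
  maps of rank one; hence \<open>D X\<close>, for \<open>D\<close> in the uncertainty set, ranges exactly over the Euclidean
  ball of radius \<open>r = lam * norm X\<close>, and the worst case is the maximum of the \<open>p\<close>-norm over the ball of
  radius \<open>r\<close> around \<open>Z\<close>.  Moving from \<open>Z\<close> radially gives the lower bound, the triangle inequality the
  upper bound.  For \<open>1 < p < \<infinity>\<close> equality in the upper bound forces \<open>Z\<close> to be parallel to a maximizer
  of the \<open>p\<close>-norm on a Euclidean sphere, and for \<open>p \<noteq> 2\<close> such a maximizer lies in a finite union
  of hyperplanes.  The lower bound is asymptotically attained far out on the ray through a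
  minimizer of the \<open>p\<close>-norm on a Euclidean sphere.\<close>

section \<open>Minkowski inequality and its equality case\<close>

text \<open>The mean value theorem on the side of \<open>m\<close> where \<open>x\<close> lies,
  together with strict monotonicity of \<open>z powr (P - 1)\<close>, puts the graph strictly above
  its tangent.\<close>

lemma powr_gt_tangent:
  fixes P x m :: real
  assumes "P > 1" "m > 0" "x \<ge> 0" "x \<noteq> m"
  shows "m powr P + P * m powr (P - 1) * (x - m) < x powr P"
proof -
  have D: "((\<lambda>x. x powr P) has_real_derivative P * z powr (P - 1)) (at z)" if "z > 0" for z
    using that by (auto intro!: derivative_eq_intros)
  consider "x = 0" | "0 < x" "x < m" | "m < x" using assms by linarith
  then show ?thesis
  proof cases
    \<comment> \<open>The derivative \<open>D\<close> is available only at positive points, so the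
      endpoint \<open>0\<close> is computed directly.\<close>
    case 1
    have "m powr P = m powr (P - 1) * m"
      using assms by (simp add: powr_diff)
    then have "m powr P + P * m powr (P - 1) * (x - m) = - ((P - 1) * m powr P)"
      using 1 by (simp add: algebra_simps)
    also have "\<dots> < 0" using assms by simp
    finally show ?thesis using 1 by simp
  next
    case 2
    obtain z where z: "x < z" "z < m" "m powr P - x powr P = (m - x) * (P * z powr (P - 1))"
      using MVT2[OF 2(2), of "\<lambda>x. x powr P" "\<lambda>z. P * z powr (P - 1)"] D 2 by auto
    have "z powr (P - 1) < m powr (P - 1)"
      using z 2 assms by (intro powr_less_mono2) auto
    then have "(m - x) * (P * z powr (P - 1)) < (m - x) * (P * m powr (P - 1))"
      using 2 assms by (intro mult_strict_left_mono) auto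
    with z show ?thesis by (simp add: algebra_simps)
  next
    case 3
    obtain z where z: "m < z" "z < x" "x powr P - m powr P = (x - m) * (P * z powr (P - 1))"
      using MVT2[OF 3, of "\<lambda>x. x powr P" "\<lambda>z. P * z powr (P - 1)"] D assms by auto
    have "m powr (P - 1) < z powr (P - 1)"
      using z assms by (intro powr_less_mono2) auto
    then have "(x - m) * (P * m powr (P - 1)) < (x - m) * (P * z powr (P - 1))"
      using 3 assms by (intro mult_strict_left_mono) auto
    with z show ?thesis by (simp add: algebra_simps)
  qed
qed

text \<open>Averages the tangent inequalities at the weighted mean \<open>m\<close>; the weighted
  deviations of \<open>x\<close> and \<open>y\<close> from \<open>m\<close> cancel.\<close>

lemma powr_convex_strict:
  fixes P x y t u :: real
  assumes "P > 1" "x \<ge> 0" "y \<ge> 0" "x \<noteq> y" "t > 0" "u > 0" "t + u = 1"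
  shows "(t * x + u * y) powr P < t * x powr P + u * y powr P"
proof -
  define m where "m = t * x + u * y"
  have m: "m > 0"
    using assms unfolding m_def
    by (cases "x = 0") (auto intro: add_pos_nonneg)
  have dx: "x - m = u * (x - y)" and dy: "y - m = - (t * (x - y))"
    using assms(7) unfolding m_def by (simp_all flip: assms(7) add: algebra_simps)
       (use assms(7) in algebra)+
  have "x \<noteq> m" "y \<noteq> m" using dx dy assms by auto
  then have "t * (m powr P + P * m powr (P - 1) * (x - m)) < t * x powr P"
    "u * (m powr P + P * m powr (P - 1) * (y - m)) < u * y powr P"
    using powr_gt_tangent assms m by simp_all
  then have "t * (m powr P + P * m powr (P - 1) * (x - m))
      + u * (m powr P + P * m powr (P - 1) * (y - m)) < t * x powr P + u * y powr P"
    by linarith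
  also have "t * (m powr P + P * m powr (P - 1) * (x - m))
      + u * (m powr P + P * m powr (P - 1) * (y - m)) = (t + u) * m powr P"
    unfolding dx dy by (simp add: algebra_simps)
  finally show ?thesis using assms by (simp add: m_def)
qed

text \<open>Strictness has two sources: cancellation of signs when \<open>y = - x\<close>, and
  strict convexity of the power when the absolute values differ.\<close>

lemma abs_powr_convex_strict:
  fixes P x y t u :: real
  assumes "P > 1" "x \<noteq> y" "t > 0" "u > 0" "t + u = 1"
  shows "\<bar>t * x + u * y\<bar> powr P < t * \<bar>x\<bar> powr P + u * \<bar>y\<bar> powr P"
proof (cases "\<bar>x\<bar> = \<bar>y\<bar>")
  case True
  then have y: "y = - x" "x \<noteq> 0" using assms by auto
  have "\<bar>t * x + u * y\<bar> = \<bar>t - u\<bar> * \<bar>x\<bar>"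
    unfolding y by (simp flip: abs_mult add: algebra_simps)
  also have "\<dots> < \<bar>x\<bar>"
    using y assms by auto
  finally have "\<bar>t * x + u * y\<bar> powr P < \<bar>x\<bar> powr P"
    using assms by (intro powr_less_mono2) auto
  also have "\<bar>x\<bar> powr P = (t + u) * \<bar>x\<bar> powr P" using assms by simp
  finally show ?thesis using y by (simp add: algebra_simps)
next
  case False
  have "\<bar>t * x + u * y\<bar> \<le> t * \<bar>x\<bar> + u * \<bar>y\<bar>"
    using abs_triangle_ineq[of "t * x" "u * y"] assms by (simp add: abs_mult)
  then have "\<bar>t * x + u * y\<bar> powr P \<le> (t * \<bar>x\<bar> + u * \<bar>y\<bar>) powr P"
    using assms by (intro powr_mono2) auto
  also have "\<dots> < t * \<bar>x\<bar> powr P + u * \<bar>y\<bar> powr P"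
    using False assms by (intro powr_convex_strict) auto
  finally show ?thesis .
qed

lemma abs_powr_convex:
  fixes P x y t u :: real
  assumes "P \<ge> 1" "t > 0" "u > 0" "t + u = 1"
  shows "\<bar>t * x + u * y\<bar> powr P \<le> t * \<bar>x\<bar> powr P + u * \<bar>y\<bar> powr P"
proof (cases "P = 1 \<or> x = y")
  case True
  then show ?thesis
  proof
    assume "P = 1"
    then show ?thesis
      using abs_triangle_ineq[of "t * x" "u * y"] assms by (simp add: abs_mult)
  next
    assume "x = y"
    then show ?thesis using assms by (simp flip: distrib_right)
  qed
next
  case False
  then show ?thesis using abs_powr_convex_strict[of P x y t u] assms by simp
qed

section \<open>Basic properties of \<open>lp_norm\<close>\<close>

lemma ereal_ge_1_cases:
  fixes p :: ereal
  assumes "1 \<le> p"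
  obtains "p = \<infinity>" | P where "p = ereal P" "1 \<le> P"
  using assms by (cases p) auto

lemma lp_norm_infinity: "lp_norm \<infinity> I f = Max ((\<lambda>i. \<bar>f i\<bar>) ` I)"
  by (simp add: lp_norm_def)

lemma lp_norm_ereal: "lp_norm (ereal P) I f = (\<Sum>i\<in>I. \<bar>f i\<bar> powr P) powr (1 / P)"
  by (simp add: lp_norm_def)

lemma lp_norm_ereal_powr:
  assumes "1 \<le> P"
  shows "lp_norm (ereal P) I f powr P = (\<Sum>i\<in>I. \<bar>f i\<bar> powr P)"
  using assms by (simp add: lp_norm_ereal powr_powr sum_nonneg)

lemma lp_norm_cong: "(\<And>i. i \<in> I \<Longrightarrow> f i = g i) \<Longrightarrow> lp_norm p I f = lp_norm p I g"
  by (simp add: lp_norm_def)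

lemma lp_norm_reindex:
  assumes "bij_betw h I J"
  shows "lp_norm p J f = lp_norm p I (\<lambda>i. f (h i))"
proof -
  have "(\<lambda>j. \<bar>f j\<bar>) ` J = (\<lambda>i. \<bar>f (h i)\<bar>) ` I"
    using bij_betw_imp_surj_on[OF assms] by auto
  then show ?thesis
    unfolding lp_norm_def by (simp add: sum.reindex_bij_betw[OF assms, symmetric])
qed

lemma lp_norm_nonneg:
  assumes "finite I" "I \<noteq> {}"
  shows "0 \<le> lp_norm p I f"
  using assms by (auto simp: lp_norm_def Max_ge_iff)

lemma lp_norm_ge_component:
  assumes "1 \<le> p" "finite I" "i \<in> I"
  shows "\<bar>f i\<bar> \<le> lp_norm p I f"
  using \<open>1 \<le> p\<close>
proof (cases rule: ereal_ge_1_cases)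
  case 1
  then show ?thesis using assms by (simp add: lp_norm_infinity)
next
  case (2 P)
  have "\<bar>f i\<bar> powr P \<le> (\<Sum>i\<in>I. \<bar>f i\<bar> powr P)"
    using assms by (intro member_le_sum) auto
  then have "(\<bar>f i\<bar> powr P) powr (1 / P) \<le> lp_norm p I f"
    using 2 by (simp add: lp_norm_ereal powr_mono2)
  then show ?thesis using 2 by (simp add: powr_powr)
qed

lemma lp_norm_scale:
  assumes "1 \<le> p" "finite I" "I \<noteq> {}"
  shows "lp_norm p I (\<lambda>i. c * f i) = \<bar>c\<bar> * lp_norm p I f"
  using \<open>1 \<le> p\<close>
proof (cases rule: ereal_ge_1_cases)
  case 1
  have "mono (\<lambda>x. \<bar>c\<bar> * x)" by (auto intro!: monoI mult_left_mono)
  from mono_Max_commute[OF this, of "(\<lambda>i. \<bar>f i\<bar>) ` I"] assms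
  show ?thesis using 1 by (simp add: lp_norm_infinity abs_mult image_image)
next
  case (2 P)
  then show ?thesis
    by (simp add: lp_norm_ereal abs_mult powr_mult powr_powr sum_nonneg flip: sum_distrib_left)
qed

lemma lp_norm_eq_0D:
  assumes "1 \<le> p" "finite I" "lp_norm p I f = 0" "i \<in> I"
  shows "f i = 0"
  using lp_norm_ge_component[of p I i f] assms by simp

text \<open>\<open>(x + y) / (a + b)\<close> is the convex combination of \<open>x / a\<close> and
  \<open>y / b\<close> with weights \<open>a / (a + b)\<close> and \<open>b / (a + b)\<close>. With
  \<open>a\<close> and \<open>b\<close> the norms of two functions, summing the first bound gives
  Minkowski and the strict one its equality case.\<close>

lemma abs_add_powr_scaled:
  fixes a b :: real
  assumes "1 \<le> P" "a > 0" "b > 0"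
  shows "\<bar>x + y\<bar> powr P
    \<le> (a + b) powr P * (a / (a + b) * \<bar>x / a\<bar> powr P + b / (a + b) * \<bar>y / b\<bar> powr P)"
    and "1 < P \<Longrightarrow> x / a \<noteq> y / b \<Longrightarrow> \<bar>x + y\<bar> powr P
    < (a + b) powr P * (a / (a + b) * \<bar>x / a\<bar> powr P + b / (a + b) * \<bar>y / b\<bar> powr P)"
proof -
  have "a / (a + b) * (x / a) = x / (a + b)" "b / (a + b) * (y / b) = y / (a + b)"
    using assms by simp_all
  then have "x + y = (a + b) * (a / (a + b) * (x / a) + b / (a + b) * (y / b))"
    using assms by (simp flip: add_divide_distrib)
  then have eq: "\<bar>x + y\<bar> powr P
      = (a + b) powr P * \<bar>a / (a + b) * (x / a) + b / (a + b) * (y / b)\<bar> powr P"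
    using assms by (metis abs_mult abs_of_pos add_pos_pos powr_mult abs_ge_zero less_imp_le)
  have tu: "a / (a + b) > 0" "b / (a + b) > 0" "a / (a + b) + b / (a + b) = 1"
    using assms by (simp_all flip: add_divide_distrib)
  show "\<bar>x + y\<bar> powr P
    \<le> (a + b) powr P * (a / (a + b) * \<bar>x / a\<bar> powr P + b / (a + b) * \<bar>y / b\<bar> powr P)"
    unfolding eq by (intro mult_left_mono abs_powr_convex tu assms) simp
  show "\<bar>x + y\<bar> powr P
    < (a + b) powr P * (a / (a + b) * \<bar>x / a\<bar> powr P + b / (a + b) * \<bar>y / b\<bar> powr P)"
    if "1 < P" "x / a \<noteq> y / b"
    unfolding eq using assms
    by (intro mult_strict_left_mono abs_powr_convex_strict tu that) simp
qed

text \<open>The normalized functions \<open>f / a\<close> and \<open>g / b\<close> have unit norm,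
  and the weights add up to 1.\<close>

lemma sum_lp_norm_scaled:
  assumes P: "1 \<le> P" and "lp_norm (ereal P) I f = a" "lp_norm (ereal P) I g = b"
    and ab: "a > 0" "b > 0"
  shows "(\<Sum>i\<in>I. (a + b) powr P * (a / (a + b) * \<bar>f i / a\<bar> powr P + b / (a + b) * \<bar>g i / b\<bar> powr P))
    = (a + b) powr P"
proof -
  define t u where "t = a / (a + b)" and "u = b / (a + b)"
  have "(\<Sum>i\<in>I. \<bar>f i\<bar> powr P) = a powr P" "(\<Sum>i\<in>I. \<bar>g i\<bar> powr P) = b powr P"
    using lp_norm_ereal_powr[OF P, of I] assms by auto
  then have "(\<Sum>i\<in>I. \<bar>f i / a\<bar> powr P) = 1" "(\<Sum>i\<in>I. \<bar>g i / b\<bar> powr P) = 1"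
    using ab by (simp_all add: abs_divide powr_divide flip: sum_divide_distrib)
  then have "(\<Sum>i\<in>I. (a + b) powr P * (t * \<bar>f i / a\<bar> powr P + u * \<bar>g i / b\<bar> powr P))
      = (a + b) powr P * (t + u)"
    by (simp only: sum.distrib mult_1_right flip: sum_distrib_left)
  also have "t + u = 1"
    using ab by (simp add: t_def u_def flip: add_divide_distrib)
  finally show ?thesis by (simp add: t_def u_def)
qed

lemma lp_norm_triangle:
  assumes "1 \<le> p" "finite I" "I \<noteq> {}"
  shows "lp_norm p I (\<lambda>i. f i + g i) \<le> lp_norm p I f + lp_norm p I g"
  using \<open>1 \<le> p\<close>
proof (cases rule: ereal_ge_1_cases)
  case 1
  have "\<bar>f i + g i\<bar> \<le> lp_norm p I f + lp_norm p I g" if "i \<in> I" for i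
    using lp_norm_ge_component[of p I i f] lp_norm_ge_component[of p I i g] that assms by linarith
  then show ?thesis using assms 1 by (simp add: lp_norm_infinity)
next
  case (2 P)
  define a b where "a = lp_norm p I f" and "b = lp_norm p I g"
  have nn: "a \<ge> 0" "b \<ge> 0" unfolding a_def b_def using lp_norm_nonneg assms by auto
  \<comment> \<open>Normalization divides by both norms; a vanishing norm means that the function is
    zero on \<open>I\<close>.\<close>
  consider "a = 0" | "b = 0" | "a > 0" "b > 0" using nn by linarith
  then show ?thesis
  proof cases
    case 1
    then have "lp_norm p I (\<lambda>i. f i + g i) = lp_norm p I g"
      using lp_norm_eq_0D[of p I f] assms by (intro lp_norm_cong) (auto simp: a_def)
    then show ?thesis using nn by (simp add: a_def)
  next
    case 2
    then have "lp_norm p I (\<lambda>i. f i + g i) = lp_norm p I f"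
      using lp_norm_eq_0D[of p I g] assms by (intro lp_norm_cong) (auto simp: b_def)
    then show ?thesis using nn by (simp add: b_def)
  next
    case 3
    have "(\<Sum>i\<in>I. \<bar>f i + g i\<bar> powr P) \<le> (a + b) powr P"
      using sum_lp_norm_scaled[OF 2(2), of I f a g b] abs_add_powr_scaled(1)[OF 2(2) 3] 3
      by (metis (no_types, lifting) 2(1) a_def b_def sum_mono)
    then have "(\<Sum>i\<in>I. \<bar>f i + g i\<bar> powr P) powr (1 / P) \<le> ((a + b) powr P) powr (1 / P)"
      using 2 by (intro powr_mono2) (auto intro: sum_nonneg)
    then show ?thesis using 2 3 by (simp add: lp_norm_ereal powr_powr a_def b_def)
  qed
qed

text \<open>If the normalized values differed at a single index, strict convexity would make that
  summand, and hence the whole Minkowski estimate, strict.\<close>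

lemma lp_norm_triangle_eqD:
  assumes P: "1 < P" and "finite I" "I \<noteq> {}"
    and ab: "lp_norm (ereal P) I f > 0" "lp_norm (ereal P) I g > 0"
    and eq: "lp_norm (ereal P) I (\<lambda>i. f i + g i) = lp_norm (ereal P) I f + lp_norm (ereal P) I g"
    and "i \<in> I"
  shows "f i / lp_norm (ereal P) I f = g i / lp_norm (ereal P) I g"
proof (rule ccontr)
  define a b where "a = lp_norm (ereal P) I f" and "b = lp_norm (ereal P) I g"
  assume "f i / lp_norm (ereal P) I f \<noteq> g i / lp_norm (ereal P) I g"
  then have ne: "f i / a \<noteq> g i / b" by (simp add: a_def b_def)
  have P1: "1 \<le> P" and ab': "a > 0" "b > 0" using P ab by (auto simp: a_def b_def)
  have "(\<Sum>i\<in>I. \<bar>f i + g i\<bar> powr P)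
      < (\<Sum>i\<in>I. (a + b) powr P * (a / (a + b) * \<bar>f i / a\<bar> powr P + b / (a + b) * \<bar>g i / b\<bar> powr P))"
    using abs_add_powr_scaled[OF P1 ab'] ne P \<open>i \<in> I\<close> \<open>finite I\<close>
    by (intro sum_strict_mono_ex1) blast+
  also have "\<dots> = (a + b) powr P"
    by (intro sum_lp_norm_scaled P1 ab') (simp_all add: a_def b_def)
  also have "\<dots> = (\<Sum>i\<in>I. \<bar>f i + g i\<bar> powr P)"
    using lp_norm_ereal_powr[OF P1, of I "\<lambda>i. f i + g i"] eq by (simp add: a_def b_def)
  finally show False by simp
qed

lemma lp_norm_2: "lp_norm 2 I f = L2_set f I"
proof -
  have "lp_norm 2 I f = (\<Sum>i\<in>I. \<bar>f i\<bar> powr 2) powr (1 / 2)"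
    using lp_norm_ereal[of 2 I f] by simp
  also have "\<dots> = L2_set f I"
    by (simp add: L2_set_def powr_half_sqrt sum_nonneg)
  finally show ?thesis .
qed

section \<open>Entrywise norms\<close>

lemma entrywise_norm_nonneg: "0 \<le> entrywise_norm p A"
  by (simp add: entrywise_norm_def lp_norm_nonneg)

lemma entrywise_norm_scaleR:
  assumes "1 \<le> p"
  shows "entrywise_norm p (c *\<^sub>R A) = \<bar>c\<bar> * entrywise_norm p A"
  using lp_norm_scale[OF assms, of UNIV c "\<lambda>(i, j). A $ i $ j"]
  by (simp add: entrywise_norm_def case_prod_unfold)

lemma entrywise_norm_triangle:
  assumes "1 \<le> p"
  shows "entrywise_norm p (A + B) \<le> entrywise_norm p A + entrywise_norm p B"
  using lp_norm_triangle[OF assms, of UNIV "\<lambda>(i, j). A $ i $ j" "\<lambda>(i, j). B $ i $ j"]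
  by (simp add: entrywise_norm_def case_prod_unfold)

lemma entrywise_norm_0: "1 \<le> p \<Longrightarrow> entrywise_norm p 0 = 0"
  using entrywise_norm_scaleR[of p 0 0] by simp

lemma entrywise_norm_eq_0_iff:
  assumes "1 \<le> p"
  shows "entrywise_norm p A = 0 \<longleftrightarrow> A = 0"
proof
  assume "entrywise_norm p A = 0"
  then have "A $ i $ j = 0" for i j
    using lp_norm_eq_0D[OF assms, of UNIV "\<lambda>(i, j). A $ i $ j" "(i, j)"]
    by (simp add: entrywise_norm_def)
  then show "A = 0" by (simp add: vec_eq_iff)
qed (use assms in \<open>simp add: entrywise_norm_0\<close>)

lemma entrywise_norm_pos: "1 \<le> p \<Longrightarrow> A \<noteq> 0 \<Longrightarrow> 0 < entrywise_norm p A"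
  using entrywise_norm_nonneg[of p A] entrywise_norm_eq_0_iff[of p A] by linarith

lemma entrywise_norm_2: "entrywise_norm 2 A = norm A"
proof -
  have "(entrywise_norm 2 A)\<^sup>2 = (norm A)\<^sup>2"
    unfolding entrywise_norm_def lp_norm_2 L2_set_def norm_vec_def UNIV_Times_UNIV[symmetric]
    by (simp add: sum_nonneg sum.cartesian_product case_prod_unfold)
  then show ?thesis
    using entrywise_norm_nonneg[of 2 A] by (simp add: power2_eq_iff_nonneg)
qed

text \<open>The triangle inequality and homogeneity give convexity, and a convex function on an open
  set of a Euclidean space is continuous.\<close>

lemma continuous_on_entrywise_norm:
  assumes "1 \<le> p"
  shows "continuous_on S (entrywise_norm p :: real^'n^'m \<Rightarrow> real)"
proof -
  have "convex_on UNIV (entrywise_norm p :: real^'n^'m \<Rightarrow> real)"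
  proof (rule convex_onI)
    fix t :: real and A B :: "real^'n^'m"
    assume "0 < t" "t < 1"
    then show "entrywise_norm p ((1 - t) *\<^sub>R A + t *\<^sub>R B)
        \<le> (1 - t) * entrywise_norm p A + t * entrywise_norm p B"
      using entrywise_norm_triangle[OF assms, of "(1 - t) *\<^sub>R A" "t *\<^sub>R B"]
      by (simp add: entrywise_norm_scaleR[OF assms])
  qed simp
  then show ?thesis
    using convex_on_continuous[OF open_UNIV] continuous_on_subset by blast
qed

section \<open>The constants \<open>delta\<close> as norm ratios of matrices\<close>

text \<open>An enumeration \<open>h\<close> of the index pairs identifies vectors of length
  \<open>CARD('m) * CARD('n)\<close> with matrices, so that later arguments stay in one Euclidean
  space.\<close>

lemma delta_eq:
  "delta (CARD('m) * CARD('n)) a b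
    = (GREATEST v. \<exists>A :: real^'n^'m. entrywise_norm b A = 1 \<and> v = entrywise_norm a A)"
proof -
  obtain h where h: "bij_betw h {..<CARD('m) * CARD('n)} (UNIV :: ('m \<times> 'n) set)"
    using ex_bij_betw_nat_finite[of "UNIV :: ('m \<times> 'n) set"] by (auto simp: lessThan_atLeast0)
  define I where "I = {..<CARD('m) * CARD('n)}"
  define f where "f A k = A $ fst (h k) $ snd (h k)" for A :: "real^'n^'m" and k
  define g :: "(nat \<Rightarrow> real) \<Rightarrow> real^'n^'m" where "g u = (\<chi> i j. u (inv_into I h (i, j)))" for u
  have f: "entrywise_norm p A = lp_norm p I (f A)" for p A
    by (simp add: entrywise_norm_def lp_norm_reindex[OF h] case_prod_unfold f_def[abs_def] I_def)
  have g: "lp_norm p I u = entrywise_norm p (g u)" for p u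
    unfolding f
    by (rule lp_norm_cong) (simp add: f_def g_def I_def bij_betw_inv_into_left[OF h])
  have "(\<exists>u. lp_norm b I u = 1 \<and> v = lp_norm a I u)
      \<longleftrightarrow> (\<exists>A :: real^'n^'m. entrywise_norm b A = 1 \<and> v = entrywise_norm a A)" (is "?L \<longleftrightarrow> ?R") for v
  proof
    show "?L \<Longrightarrow> ?R" unfolding g by blast
    show "?R \<Longrightarrow> ?L" unfolding f by blast
  qed
  then show ?thesis unfolding delta_def I_def by presburger
qed

text \<open>The constant is the minimum of the norm on the compact Euclidean unit sphere. It serves
  to bound the unit spheres of the entrywise norms.\<close>

lemma entrywise_norm_ge_norm:
  assumes "1 \<le> p"
  shows "\<exists>c>0. \<forall>A :: real^'n^'m. c * norm A \<le> entrywise_norm p A"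
proof -
  obtain B :: "real^'n^'m" where B: "norm B = 1"
    "\<And>A :: real^'n^'m. norm A = 1 \<Longrightarrow> entrywise_norm p B \<le> entrywise_norm p A"
    using continuous_attains_inf[OF compact_sphere _ continuous_on_entrywise_norm[OF assms],
        of "0 :: real^'n^'m" 1] by (auto simp: dist_norm)
  have "entrywise_norm p B * norm A \<le> entrywise_norm p A" for A :: "real^'n^'m"
  proof (cases "A = 0")
    case False
    then show ?thesis
      using B(2)[of "(1 / norm A) *\<^sub>R A"]
      by (simp add: entrywise_norm_scaleR[OF assms] field_simps)
  qed (simp add: entrywise_norm_nonneg)
  moreover have "entrywise_norm p B > 0"
    using B(1) by (intro entrywise_norm_pos assms) auto
  ultimately show ?thesis by blast
qed

text \<open>\<open>GREATEST\<close> has a meaning only once a maximum exists; here it comes from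
  compactness of the unit sphere of the \<open>b\<close>-norm, which is closed by continuity and
  bounded by \<open>entrywise_norm_ge_norm\<close>.\<close>

lemma delta_attained:
  assumes "1 \<le> a" "1 \<le> b"
  obtains A :: "real^'n^'m" where "entrywise_norm b A = 1"
    "entrywise_norm a A = delta (CARD('m) * CARD('n)) a b"
    "\<And>B :: real^'n^'m. entrywise_norm b B = 1 \<Longrightarrow>
      entrywise_norm a B \<le> delta (CARD('m) * CARD('n)) a b"
proof -
  let ?S = "{A :: real^'n^'m. entrywise_norm b A = 1}"
  obtain c where c: "c > 0" "\<And>A :: real^'n^'m. c * norm A \<le> entrywise_norm b A"
    using entrywise_norm_ge_norm[OF assms(2)] by blast
  have "norm A \<le> 1 / c" if "A \<in> ?S" for A
    using c(2)[of A] that c(1) by (simp add: field_simps)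
  then have "bounded ?S" by (meson boundedI)
  moreover have "closed ?S"
    using continuous_closed_preimage_constant[OF continuous_on_entrywise_norm[OF assms(2)], of UNIV 1]
    by simp
  ultimately have "compact ?S" by (simp add: compact_eq_bounded_closed)
  moreover have "?S \<noteq> {}"
  proof -
    obtain B :: "real^'n^'m" where "B \<noteq> 0"
      using nonzero_Basis nonempty_Basis by blast
    then have "(1 / entrywise_norm b B) *\<^sub>R B \<in> ?S"
      using entrywise_norm_pos[OF assms(2), of B] by (simp add: entrywise_norm_scaleR[OF assms(2)])
    then show ?thesis by blast
  qed
  ultimately obtain A where A: "A \<in> ?S" "\<And>B. B \<in> ?S \<Longrightarrow> entrywise_norm a B \<le> entrywise_norm a A"
    using continuous_attains_sup[OF _ _ continuous_on_entrywise_norm[OF assms(1)], of ?S] by blast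
  have "delta (CARD('m) * CARD('n)) a b = entrywise_norm a A"
    unfolding delta_eq[where 'm = 'm and 'n = 'n] using A by (intro Greatest_equality) auto
  with A that show ?thesis by auto
qed

lemma entrywise_norm_le_delta:
  fixes A :: "real^'n^'m"
  assumes "1 \<le> a" "1 \<le> b"
  shows "entrywise_norm a A \<le> delta (CARD('m) * CARD('n)) a b * entrywise_norm b A"
proof (cases "A = 0")
  case False
  then have pos: "entrywise_norm b A > 0" using entrywise_norm_pos assms by blast
  have "entrywise_norm a ((1 / entrywise_norm b A) *\<^sub>R A) \<le> delta (CARD('m) * CARD('n)) a b"
  proof (rule delta_attained[OF assms, where 'n='n and 'm='m])
    assume max: "\<And>B :: real^'n^'m. entrywise_norm b B = 1 \<Longrightarrow>
      entrywise_norm a B \<le> delta (CARD('m) * CARD('n)) a b"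
    show ?thesis
      using pos by (intro max) (simp add: entrywise_norm_scaleR[OF assms(2)])
  qed
  then show ?thesis using pos by (simp add: entrywise_norm_scaleR[OF assms(1)] field_simps)
qed (simp add: entrywise_norm_0 assms)

lemma norm_le_delta:
  fixes A :: "real^'n^'m"
  assumes "1 \<le> p"
  shows "norm A \<le> delta (CARD('m) * CARD('n)) 2 p * entrywise_norm p A"
  using entrywise_norm_le_delta[OF _ assms, of 2 A] unfolding entrywise_norm_2 by simp

lemma entrywise_norm_le_delta_norm:
  fixes A :: "real^'n^'m"
  assumes "1 \<le> p"
  shows "entrywise_norm p A \<le> delta (CARD('m) * CARD('n)) p 2 * norm A"
  using entrywise_norm_le_delta[OF assms, of 2 A] unfolding entrywise_norm_2 by simp

lemma delta_pos:
  assumes "1 \<le> a" "1 \<le> b"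
  shows "0 < delta (CARD('m::finite) * CARD('n::finite)) a b"
proof -
  obtain A :: "real^'n^'m" where A: "entrywise_norm b A = 1"
    "entrywise_norm a A = delta (CARD('m) * CARD('n)) a b"
    using delta_attained[OF assms] by metis
  then have "A \<noteq> 0" using assms(2) by (auto simp: entrywise_norm_0)
  then show ?thesis using entrywise_norm_pos[OF assms(1), of A] A by simp
qed

section \<open>Schatten norms and the uncertainty set\<close>

lemma gram_inner:
  fixes A :: "real^'n^'m"
  shows "((transpose A ** A) *v x) \<bullet> y = (A *v x) \<bullet> (A *v y)"
  by (simp add: transpose_matrix_vector dot_lmul_matrix flip: matrix_vector_mul_assoc)

lemma gram_inner_commute:
  fixes A :: "real^'n^'m"
  shows "((transpose A ** A) *v x) \<bullet> y = x \<bullet> ((transpose A ** A) *v y)"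
  by (metis gram_inner inner_commute)

text \<open>Translates the multiplicities in \<open>singular_values\<close> into existence of
  nonzero eigenvectors.\<close>

lemma dim_pos_iff:
  fixes V :: "'a::euclidean_space set"
  shows "0 < dim V \<longleftrightarrow> (\<exists>x\<in>V. x \<noteq> 0)"
  using dim_eq_0[of V] by (metis gr0I insertI1 insert_iff less_irrefl singletonD subset_iff)

text \<open>A unit vector \<open>x\<close> maximizing \<open>norm (A *v x)\<close> is an eigenvector
  of the Gram matrix, so the operator norm is itself a singular value.\<close>

lemma singular_value_bounding_norm:
  fixes A :: "real^'k^'k"
  obtains s where "(s, 0) \<in> singular_values A" "\<And>y. norm (A *v y) \<le> s * norm y"
proof -
  have cont: "continuous_on S (\<lambda>y. norm (A *v y))" for S
    by (intro continuous_intros linear_continuous_on matrix_vector_mul_bounded_linear)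
  obtain x where x: "norm x = 1" "\<And>y. norm y = 1 \<Longrightarrow> norm (A *v y) \<le> norm (A *v x)"
    using continuous_attains_sup[OF compact_sphere _ cont, of "0 :: real^'k" 1] by (auto simp: dist_norm)
  define s where "s = norm (A *v x)"
  have bound: "norm (A *v y) \<le> s * norm y" for y
  proof (cases "y = 0")
    case False
    then show ?thesis
      using x(2)[of "(1 / norm y) *\<^sub>R y"]
      by (simp add: s_def matrix_vector_mult_scaleR field_simps)
  qed simp
  \<comment> \<open>\<open>g\<close> turns the constrained maximum into an unconstrained minimum: it
    is nonnegative everywhere and zero at \<open>x\<close>. Its vanishing derivative there is the
    eigenvector equation.\<close>
  define g where "g y = s\<^sup>2 * (y \<bullet> y) - (A *v y) \<bullet> (A *v y)" for y
  have "g y \<ge> 0" for y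
    using power_mono[OF bound[of y] norm_ge_zero, of 2]
    by (simp add: g_def power_mult_distrib power2_norm_eq_inner)
  moreover have "g x = 0"
    using x(1) by (simp add: g_def s_def power2_norm_eq_inner norm_eq_1)
  ultimately have min: "\<forall>y\<in>UNIV. g x \<le> g y" by simp
  have "(g has_derivative (\<lambda>h. s\<^sup>2 * (x \<bullet> h + h \<bullet> x) - ((A *v x) \<bullet> (A *v h) + (A *v h) \<bullet> (A *v x)))) (at x)"
    unfolding g_def
    by (auto intro!: derivative_eq_intros
        bounded_linear.has_derivative[OF matrix_vector_mul_bounded_linear])
  note differential_zero_maxmin[OF UNIV_I open_UNIV this disjI2, OF min]
  from fun_cong[OF this] have eq: "s\<^sup>2 * (x \<bullet> h + h \<bullet> x) - ((A *v x) \<bullet> (A *v h) + (A *v h) \<bullet> (A *v x)) = 0" for h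
    by simp
  have "((transpose A ** A) *v x) \<bullet> h = (s\<^sup>2 *\<^sub>R x) \<bullet> h" for h
    using eq[of h] by (simp add: gram_inner inner_commute[of h x] inner_commute[of "A *v h" "A *v x"])
  then have "(transpose A ** A) *v x = s\<^sup>2 *\<^sub>R x"
    using vector_eq_rdot by blast
  moreover have "x \<noteq> 0" using x(1) by auto
  ultimately have "\<exists>z\<in>{x. (transpose A ** A) *v x = s\<^sup>2 *\<^sub>R x}. z \<noteq> 0" by blast
  then have "0 < dim {x. (transpose A ** A) *v x = s\<^sup>2 *\<^sub>R x}" unfolding dim_pos_iff .
  then have "(s, 0) \<in> singular_values A" by (simp add: singular_values_def s_def)
  then show ?thesis using that bound by blast
qed

text \<open>Eigenvectors of the symmetric matrix \<open>transpose A ** A\<close> for distinct eigenvalues are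
  orthogonal, hence independent.\<close>

lemma finite_singular_values:
  fixes A :: "real^'k^'k"
  shows "finite (singular_values A)"
proof -
  let ?M = "transpose A ** A"
  let ?V = "\<lambda>s. {x. ?M *v x = s\<^sup>2 *\<^sub>R x}"
  define E where "E = {s. 0 \<le> s \<and> (\<exists>x\<in>?V s. x \<noteq> 0)}"
  have "\<forall>s\<in>E. \<exists>x. ?M *v x = s\<^sup>2 *\<^sub>R x \<and> x \<noteq> 0" by (auto simp: E_def)
  then obtain v where v: "\<And>s. s \<in> E \<Longrightarrow> ?M *v v s = s\<^sup>2 *\<^sub>R v s \<and> v s \<noteq> 0"
    by metis
  have orth: "v s \<bullet> v t = 0" if "s \<in> E" "t \<in> E" "s \<noteq> t" for s t
  proof -
    have "s\<^sup>2 * (v s \<bullet> v t) = t\<^sup>2 * (v s \<bullet> v t)"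
      using gram_inner_commute[of A "v s" "v t"] v that by simp
    moreover have "s\<^sup>2 \<noteq> t\<^sup>2"
      using that by (simp add: E_def power2_eq_iff_nonneg)
    ultimately show ?thesis by simp
  qed
  have "inj_on v E"
    using orth v by (metis inj_onI inner_eq_zero_iff)
  moreover have "pairwise orthogonal (v ` E)" "0 \<notin> v ` E"
    using orth v by (auto simp: pairwise_def orthogonal_def)
  then have "finite (v ` E)"
    using pairwise_orthogonal_independent independent_bound_general by blast
  ultimately have "finite E" using finite_imageD by blast
  \<comment> \<open>Values \<open>s\<close> with trivial eigenspace contribute no pair, and every
    other \<open>s\<close> contributes finitely many.\<close>
  moreover have "singular_values A \<subseteq> (SIGMA s:E. {..<dim (?V s)})"
  proof
    fix z assume "z \<in> singular_values A"
    then obtain s i where z: "z = (s, i)" "0 \<le> s" "i < dim (?V s)"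
      by (auto simp: singular_values_def)
    then have "\<exists>x\<in>?V s. x \<noteq> 0" using dim_pos_iff[of "?V s"] by linarith
    with z show "z \<in> (SIGMA s:E. {..<dim (?V s)})" by (auto simp: E_def)
  qed
  ultimately show ?thesis
    by (meson finite_SigmaI finite_lessThan finite_subset)
qed

text \<open>The operator norm is one of the singular values, and any component is at most the
  \<open>q\<close>-norm of the whole family.\<close>

lemma norm_le_schatten_norm:
  fixes A :: "real^'k^'k"
  assumes "1 \<le> q"
  shows "norm (A *v y) \<le> schatten_norm q A * norm y"
proof -
  obtain s where s: "(s, 0) \<in> singular_values A" "\<And>y. norm (A *v y) \<le> s * norm y"
    using singular_value_bounding_norm by blast
  from s(1) have "\<bar>fst (s, 0 :: nat)\<bar> \<le> schatten_norm q A"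
    unfolding schatten_norm_def by (intro lp_norm_ge_component assms finite_singular_values)
  then have "s * norm y \<le> schatten_norm q A * norm y"
    by (intro mult_right_mono) auto
  then show ?thesis using s(2)[of y] by linarith
qed

text \<open>The Gram matrix also has rank at most one, so the only possible nonzero singular value
  is \<open>norm x * norm y\<close>, with multiplicity one; zeros do not affect any
  \<open>q\<close>-norm.\<close>

lemma schatten_norm_rank_one:
  fixes A :: "real^'k^'k"
  assumes A: "\<And>v. A *v v = (x \<bullet> v) *\<^sub>R y" and "1 \<le> q"
  shows "schatten_norm q A \<le> norm x * norm y"
proof -
  let ?V = "\<lambda>s. {v. (transpose A ** A) *v v = s\<^sup>2 *\<^sub>R v}"
  define \<sigma> where "\<sigma> = norm x * norm y"
  have gram: "(transpose A ** A) *v v = ((x \<bullet> v) * (y \<bullet> y)) *\<^sub>R x" for v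
  proof -
    have "((transpose A ** A) *v v) \<bullet> h = (((x \<bullet> v) * (y \<bullet> y)) *\<^sub>R x) \<bullet> h" for h
      by (simp add: gram_inner A)
    then show ?thesis using vector_eq_rdot by blast
  qed
  \<comment> \<open>An upper bound on the multiplicity of zero is enough, since enlarging the index
    set can only increase the sum.\<close>
  have sub: "singular_values A \<subseteq> insert (\<sigma>, 0) ({0} \<times> {..<CARD('k)})"
  proof
    fix z assume "z \<in> singular_values A"
    then obtain s i where z: "z = (s, i)" "0 \<le> s" "i < dim (?V s)"
      by (auto simp: singular_values_def)
    show "z \<in> insert (\<sigma>, 0) ({0} \<times> {..<CARD('k)})"
    proof (cases "s = 0")
      case True
      then show ?thesis using z dim_subset_UNIV[of "?V s"] by simp
    next
      case False
      have span: "?V s \<subseteq> span {x}"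
      proof
        fix v assume "v \<in> ?V s"
        then have "((x \<bullet> v) * (y \<bullet> y)) *\<^sub>R x = s\<^sup>2 *\<^sub>R v" by (simp add: gram)
        then have "v = (((x \<bullet> v) * (y \<bullet> y)) / s\<^sup>2) *\<^sub>R x"
          using False by (simp add: divide_inverse_commute flip: scaleR_scaleR) simp
        then show "v \<in> span {x}" unfolding span_singleton by blast
      qed
      then have "dim (?V s) \<le> 1"
        using dim_le_card[OF span] by simp
      then have "i = 0" using z by simp
      obtain v where v: "v \<in> ?V s" "v \<noteq> 0" using z dim_pos_iff[of "?V s"] by auto
      then obtain c where c: "v = c *\<^sub>R x" using span by (auto simp: span_singleton)
      then have "((x \<bullet> x) * (y \<bullet> y)) *\<^sub>R v = s\<^sup>2 *\<^sub>R v"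
        using v gram[of v] by (simp add: algebra_simps)
      then have "s\<^sup>2 = \<sigma>\<^sup>2"
        using v by (simp add: \<sigma>_def power_mult_distrib power2_norm_eq_inner)
      then have "s = \<sigma>" using z by (simp add: \<sigma>_def power2_eq_iff_nonneg)
      then show ?thesis using z \<open>i = 0\<close> by simp
    qed
  qed
  have \<sigma>: "\<sigma> \<ge> 0" by (simp add: \<sigma>_def)
  show ?thesis
    using \<open>1 \<le> q\<close>
  proof (cases rule: ereal_ge_1_cases)
    case 1
    have "\<bar>fst z\<bar> \<le> \<sigma>" if "z \<in> singular_values A" for z
      using subsetD[OF sub that] \<sigma> by auto
    \<comment> \<open>\<open>Max\<close> is meaningful only on a nonempty set.\<close>
    moreover have "singular_values A \<noteq> {}"
      using singular_value_bounding_norm[of A] by blast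
    ultimately show ?thesis
      using finite_singular_values[of A]
      by (simp add: 1 schatten_norm_def lp_norm_infinity \<sigma>_def)
  next
    case (2 Q)
    have "(\<Sum>z\<in>singular_values A. \<bar>fst z\<bar> powr Q)
        \<le> (\<Sum>z\<in>insert (\<sigma>, 0) ({0} \<times> {..<CARD('k)}). \<bar>fst z\<bar> powr Q)"
      by (intro sum_mono2 sub) auto
    also have "\<dots> = (\<Sum>z\<in>{(\<sigma>, 0 :: nat)}. \<bar>fst z\<bar> powr Q)"
      by (intro sum.mono_neutral_right) auto
    also have "\<dots> = \<sigma> powr Q" using \<sigma> by simp
    finally have "schatten_norm q A \<le> (\<sigma> powr Q) powr (1 / Q)"
      using 2 by (simp add: schatten_norm_def lp_norm_ereal powr_mono2 sum_nonneg)
    then show ?thesis using 2 \<sigma> by (simp add: powr_powr \<sigma>_def)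
  qed
qed

section \<open>Linear maps on matrices in coordinates, and the reachable perturbations\<close>

text \<open>Coordinates with respect to the matrix units, indexed as in
  \<open>rep_matrix\<close>.\<close>

definition vectorize :: "real^'n^'m \<Rightarrow> real^('m \<times> 'n)" where
  "vectorize X = (\<chi> r. X $ fst r $ snd r)"

lemma inner_vectorize: "vectorize X \<bullet> vectorize Y = X \<bullet> Y"
  by (simp add: vectorize_def inner_vec_def sum.cartesian_product case_prod_unfold)

lemma norm_vectorize: "norm (vectorize X) = norm X"
  by (simp add: norm_eq_sqrt_inner inner_vectorize)

lemma matrix_expansion:
  fixes X :: "real^'n^'m"
  shows "X = (\<Sum>r\<in>UNIV. (X $ fst r $ snd r) *\<^sub>R axis (fst r) (axis (snd r) 1))"
proof -
  have "(\<Sum>r\<in>UNIV. (X $ fst r $ snd r) *\<^sub>R axis (fst r) (axis (snd r) 1 :: real^'n)) $ i $ j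
      = (\<Sum>r\<in>UNIV. if r = (i, j) then X $ i $ j else 0)" for i j
    unfolding sum_component by (intro sum.cong) (auto simp: axis_def)
  then show ?thesis by (simp add: vec_eq_iff)
qed

text \<open>The columns of \<open>rep_matrix D\<close> are the images of the matrix units, which
  determine a linear \<open>D\<close>.\<close>

lemma rep_matrix_mult:
  fixes D :: "real^'n^'m \<Rightarrow> real^'n^'m"
  assumes "linear D"
  shows "rep_matrix D *v vectorize X = vectorize (D X)"
proof -
  have "D X = (\<Sum>r\<in>UNIV. (X $ fst r $ snd r) *\<^sub>R D (axis (fst r) (axis (snd r) 1)))"
    by (subst matrix_expansion[of X]) (simp add: linear_sum[OF assms] linear_scale[OF assms])
  then have "D X $ i $ j
      = (\<Sum>r\<in>UNIV. (X $ fst r $ snd r) * D (axis (fst r) (axis (snd r) 1)) $ i $ j)" for i j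
    by simp
  then show ?thesis
    by (simp add: vec_eq_iff rep_matrix_def vectorize_def matrix_vector_mult_def mult.commute)
qed

lemma surj_vectorize: "\<exists>X. v = vectorize X"
  by (rule exI[of _ "\<chi> i j. v $ (i, j)"]) (simp add: vectorize_def vec_eq_iff)

lemma uncertainty_set_norm_le:
  assumes "D \<in> uncertainty_set q lam" "1 \<le> q"
  shows "norm (D X) \<le> lam * norm X"
proof -
  have "linear D" "schatten_norm q (rep_matrix D) \<le> lam"
    using assms by (auto simp: uncertainty_set_def)
  have "norm (D X) = norm (rep_matrix D *v vectorize X)"
    by (simp add: rep_matrix_mult[OF \<open>linear D\<close>] norm_vectorize)
  also have "\<dots> \<le> schatten_norm q (rep_matrix D) * norm X"
    using norm_le_schatten_norm[OF assms(2)] norm_vectorize by metis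
  also have "\<dots> \<le> lam * norm X"
    using \<open>schatten_norm q (rep_matrix D) \<le> lam\<close> by (simp add: mult_right_mono)
  finally show ?thesis .
qed

text \<open>Converse of \<open>uncertainty_set_norm_le\<close>: a map of rank at most one sends
  \<open>X\<close> to any point of the ball, and its Schatten norm is controlled for every
  \<open>q\<close> at once.\<close>

lemma uncertainty_set_attains:
  fixes X Y :: "real^'n^'m"
  assumes "1 \<le> q" "0 \<le> lam" "norm Y \<le> lam * norm X"
  obtains D where "D \<in> uncertainty_set q lam" "D X = Y"
proof -
  \<comment> \<open>For \<open>X \<noteq> 0\<close>, \<open>W \<bullet> X = 1\<close> and
    \<open>norm W = 1 / norm X\<close>. For \<open>X = 0\<close>, division by zero yields
    \<open>W = 0\<close>, and the hypothesis forces \<open>Y = 0\<close>.\<close>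
  define W where "W = (1 / (norm X)\<^sup>2) *\<^sub>R X"
  define D where "D V = (W \<bullet> V) *\<^sub>R Y" for V
  have lin: "linear D"
    by (rule linearI) (simp_all add: D_def inner_add_right scaleR_left_distrib)
  have "rep_matrix D *v v = (vectorize W \<bullet> v) *\<^sub>R vectorize Y" for v
  proof -
    obtain V where "v = vectorize V" using surj_vectorize by blast
    then show ?thesis
      by (simp add: rep_matrix_mult[OF lin] inner_vectorize D_def) (simp add: vectorize_def vec_eq_iff)
  qed
  from schatten_norm_rank_one[OF this \<open>1 \<le> q\<close>]
  have "schatten_norm q (rep_matrix D) \<le> norm W * norm Y" by (simp add: norm_vectorize)
  also have "\<dots> \<le> lam"
    using assms by (cases "X = 0") (simp_all add: W_def power2_eq_square field_simps)
  finally have "D \<in> uncertainty_set q lam" using lin by (simp add: uncertainty_set_def)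
  moreover have "D X = Y"
    using assms by (cases "X = 0") (simp_all add: D_def W_def power2_norm_eq_inner)
  ultimately show ?thesis using that by blast
qed

section \<open>The worst case\<close>

text \<open>A maximizer over the compact ball of perturbations \<open>Y\<close> is realized as
  \<open>D X\<close>. This justifies the \<open>GREATEST\<close> and reduces later estimates to the
  ball.\<close>

lemma worst_case_attained:
  fixes Z X :: "real^'n^'m"
  assumes "1 \<le> p" "1 \<le> q" "0 \<le> lam"
  obtains D where "D \<in> uncertainty_set q lam"
    "worst_case p q lam Z X = entrywise_norm p (Z + D X)"
    "\<And>Y. norm Y \<le> lam * norm X \<Longrightarrow> entrywise_norm p (Z + Y) \<le> worst_case p q lam Z X"
    "norm (D X) \<le> lam * norm X"
proof -
  have "continuous_on (cball 0 (lam * norm X)) (\<lambda>Y. entrywise_norm p (Z + Y))"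
    by (intro continuous_on_compose2[OF continuous_on_entrywise_norm[OF assms(1), of UNIV]]
        continuous_intros) auto
  then obtain Y where Y: "Y \<in> cball 0 (lam * norm X)"
    "\<And>Y'. Y' \<in> cball 0 (lam * norm X) \<Longrightarrow> entrywise_norm p (Z + Y') \<le> entrywise_norm p (Z + Y)"
    using continuous_attains_sup[of "cball 0 (lam * norm X)" "\<lambda>Y. entrywise_norm p (Z + Y)"] assms
    by (metis cball_eq_empty compact_cball mult_nonneg_nonneg norm_ge_zero not_less)
  obtain D where D: "D \<in> uncertainty_set q lam" "D X = Y"
    using Y(1) uncertainty_set_attains[OF assms(2,3)] by auto
  have "worst_case p q lam Z X = entrywise_norm p (Z + D X)"
    unfolding worst_case_def
    using D Y(2) uncertainty_set_norm_le[OF _ assms(2)] by (intro Greatest_equality) auto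
  then show ?thesis using D Y that by simp
qed

text \<open>The perturbation \<open>r *\<^sub>R W\<close> along the ray of \<open>Z\<close> makes
  the norms add up, and a unit vector \<open>W\<close> has \<open>p\<close>-norm at least
  \<open>1 / d\<close>.\<close>

lemma worst_case_ge:
  fixes Z X :: "real^'n^'m"
  assumes "1 \<le> p" "1 \<le> q" "0 \<le> lam"
  shows "entrywise_norm p Z + lam / delta (CARD('m) * CARD('n)) 2 p * norm X
    \<le> worst_case p q lam Z X"
proof -
  define d where "d = delta (CARD('m) * CARD('n)) 2 p"
  define r where "r = lam * norm X"
  have d: "d > 0" unfolding d_def using delta_pos[of 2 p] assms by simp
  have r: "r \<ge> 0" using assms by (simp add: r_def)
  have le: "norm A \<le> d * entrywise_norm p A" for A :: "real^'n^'m"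
    using norm_le_delta[of p A] assms by (simp add: d_def)
  obtain W :: "real^'n^'m" and c where W: "norm W = 1" and c: "c \<ge> 0" "Z = c *\<^sub>R W"
  proof (cases "Z = 0")
    \<comment> \<open>At the origin there is no preferred ray, and any unit vector will do.\<close>
    case True
    obtain W :: "real^'n^'m" where "norm W = 1" using vector_choose_size[of 1] by auto
    with True that[of W 0] show ?thesis by simp
  next
    case False
    then show ?thesis using that[of "sgn Z" "norm Z"] by (simp add: norm_sgn sgn_div_norm)
  qed
  have "Z + r *\<^sub>R W = (c + r) *\<^sub>R W" by (simp add: c scaleR_left_distrib)
  then have "entrywise_norm p (Z + r *\<^sub>R W) = entrywise_norm p Z + r * entrywise_norm p W"
    using c r by (simp add: entrywise_norm_scaleR[OF assms(1)] distrib_right)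
  moreover have "r * (1 / d) \<le> r * entrywise_norm p W"
    using le[of W] W d r by (intro mult_left_mono) (auto simp: field_simps)
  moreover have "entrywise_norm p (Z + r *\<^sub>R W) \<le> worst_case p q lam Z X"
    using worst_case_attained[OF assms, of Z X] W r by (metis abs_of_nonneg mult_1_right norm_scaleR order_refl r_def)
  ultimately show ?thesis by (simp add: r_def d_def)
qed

lemma worst_case_le:
  fixes Z X :: "real^'n^'m"
  assumes "1 \<le> p" "1 \<le> q" "0 \<le> lam"
  shows "worst_case p q lam Z X
    \<le> entrywise_norm p Z + lam * delta (CARD('m) * CARD('n)) p 2 * norm X"
proof -
  define d where "d = delta (CARD('m) * CARD('n)) p 2"
  have d: "d > 0" unfolding d_def using delta_pos[of p 2] assms by simp
  obtain D where D: "worst_case p q lam Z X = entrywise_norm p (Z + D X)"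
      "norm (D X) \<le> lam * norm X"
    using worst_case_attained[OF assms] by metis
  have "entrywise_norm p (Z + D X) \<le> entrywise_norm p Z + entrywise_norm p (D X)"
    using entrywise_norm_triangle assms by blast
  also have "entrywise_norm p (D X) \<le> d * norm (D X)"
    using entrywise_norm_le_delta_norm[of p "D X"] assms by (simp add: d_def)
  also have "\<dots> \<le> d * (lam * norm X)"
    using D d by (intro mult_left_mono) auto
  finally show ?thesis using D by (simp add: d_def mult_ac)
qed

section \<open>Strictness of the upper bound for almost all \<open>Z\<close>\<close>

lemma entrywise_norm_powr:
  assumes "1 \<le> P"
  shows "entrywise_norm (ereal P) A powr P = (\<Sum>r\<in>UNIV. \<bar>A $ fst r $ snd r\<bar> powr P)"
  using lp_norm_ereal_powr[OF assms] by (simp add: entrywise_norm_def case_prod_unfold)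

text \<open>First-order condition under rotation in the plane of two entries, keeping the sum of their
  squares fixed; in terms of the square \<open>t\<close> of one entry, \<open>t powr (P/2) + (S - t) powr (P/2)\<close> is
  maximal.\<close>

lemma delta_maximizer_critical:
  fixes A :: "real^'n^'m"
  assumes P: "1 < P" "P \<noteq> 2"
    and max: "entrywise_norm (ereal P) A = delta (CARD('m) * CARD('n)) (ereal P) 2 * norm A"
    and kl: "(a, b) \<noteq> (c, d)"
  shows "A $ a $ b = 0 \<or> A $ c $ d = 0 \<or> (A $ a $ b)\<^sup>2 = (A $ c $ d)\<^sup>2"
proof (rule ccontr)
  assume neg: "\<not> ?thesis"
  define x y where "x = A $ a $ b" and "y = A $ c $ d"
  define S where "S = x\<^sup>2 + y\<^sup>2"
  \<comment> \<open>The two entries move with their squares adding up to \<open>S\<close>. Their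
    signs are dropped, which neither norm notices, so \<open>t = x\<^sup>2\<close> stands for
    \<open>A\<close> itself.\<close>
  define B :: "real \<Rightarrow> real^'n^'m" where "B t = (\<chi> i j. if (i, j) = (a, b) then sqrt t
    else if (i, j) = (c, d) then sqrt (S - t) else A $ i $ j)" for t
  have xy: "x \<noteq> 0" "y \<noteq> 0" "x\<^sup>2 \<noteq> y\<^sup>2" using neg by (auto simp: x_def y_def)
  have split: "sum h UNIV = h (a, b) + h (c, d) + sum h (UNIV - {(a, b), (c, d)})"
    for h :: "'m \<times> 'n \<Rightarrow> real"
    using kl by (subst sum.subset_diff[of "{(a, b), (c, d)}"]) auto
  have same: "(\<Sum>r\<in>UNIV - {(a, b), (c, d)}. h (B t $ fst r $ snd r))
      = (\<Sum>r\<in>UNIV - {(a, b), (c, d)}. h (A $ fst r $ snd r))" for h :: "real \<Rightarrow> real" and t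
    by (intro sum.cong) (auto simp: B_def)
  have B_entries: "B t $ a $ b = sqrt t" "B t $ c $ d = sqrt (S - t)" for t
    using kl by (auto simp: B_def)
  have norm_powr: "(norm M)\<^sup>2 = (\<Sum>r\<in>UNIV. (M $ fst r $ snd r)\<^sup>2)" for M :: "real^'n^'m"
    unfolding power2_norm_eq_inner inner_vec_def UNIV_Times_UNIV[symmetric]
    by (simp add: sum.cartesian_product case_prod_unfold power2_eq_square)
  define \<phi> where "\<phi> t = t powr (P / 2) + (S - t) powr (P / 2)" for t
  have le: "\<phi> t \<le> \<phi> (x\<^sup>2)" if t: "0 < t" "t < S" for t
  proof -
    have "(norm (B t))\<^sup>2 = (norm A)\<^sup>2"
      unfolding norm_powr split[of "\<lambda>r. (_ $ fst r $ snd r)\<^sup>2"] same[of "\<lambda>z. z\<^sup>2"]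
      using t by (simp add: B_entries S_def x_def y_def)
    then have "norm (B t) = norm A" by (simp add: power2_eq_iff_nonneg)
    then have "entrywise_norm (ereal P) (B t) \<le> entrywise_norm (ereal P) A"
      using entrywise_norm_le_delta_norm[of "ereal P" "B t"] P by (simp add: max)
    then have "entrywise_norm (ereal P) (B t) powr P \<le> entrywise_norm (ereal P) A powr P"
      using P by (intro powr_mono2 entrywise_norm_nonneg) auto
    moreover have sqrt_powr: "sqrt s powr P = s powr (P / 2)" if "s \<ge> 0" for s
      using that by (simp add: powr_powr flip: powr_half_sqrt)
    have abs_powr: "\<bar>s\<bar> powr P = s\<^sup>2 powr (P / 2)" for s
      using sqrt_powr[of "s\<^sup>2"] by simp
    have "entrywise_norm (ereal P) M powr P = \<bar>M $ a $ b\<bar> powr P + \<bar>M $ c $ d\<bar> powr P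
        + (\<Sum>r\<in>UNIV - {(a, b), (c, d)}. \<bar>M $ fst r $ snd r\<bar> powr P)" for M :: "real^'n^'m"
      using P by (simp add: entrywise_norm_powr split)
    ultimately show ?thesis
      using t
      by (simp add: same[of "\<lambda>z. z\<^sup>2 powr (P / 2)"] B_entries \<phi>_def S_def sqrt_powr
          abs_powr x_def y_def)
  qed
  have der: "(\<phi> has_real_derivative (P / 2 * (x\<^sup>2) powr (P / 2 - 1) - P / 2 * (y\<^sup>2) powr (P / 2 - 1)))
      (at (x\<^sup>2))"
    unfolding \<phi>_def using xy by (auto intro!: derivative_eq_intros simp: S_def)
  have "P / 2 * (x\<^sup>2) powr (P / 2 - 1) - P / 2 * (y\<^sup>2) powr (P / 2 - 1) = 0"
  proof (rule DERIV_local_max[OF der])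
    \<comment> \<open>This radius keeps \<open>t\<close> strictly between \<open>0\<close> and
      \<open>S\<close>, where \<open>le\<close> applies.\<close>
    show "0 < min (x\<^sup>2) (y\<^sup>2)" using xy by simp
    show "\<forall>t. \<bar>x\<^sup>2 - t\<bar> < min (x\<^sup>2) (y\<^sup>2) \<longrightarrow> \<phi> t \<le> \<phi> (x\<^sup>2)"
      using le by (auto simp: S_def)
  qed
  then have "(x\<^sup>2) powr (P / 2 - 1) = (y\<^sup>2) powr (P / 2 - 1)" using P by simp
  \<comment> \<open>Here \<open>P \<noteq> 2\<close> enters: the exponent is nonzero, so the power
    is injective on positive numbers.\<close>
  then have "(P / 2 - 1) * ln (x\<^sup>2) = (P / 2 - 1) * ln (y\<^sup>2)"
    using xy by (simp add: powr_def)
  then have "x\<^sup>2 = y\<^sup>2" using P xy by simp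
  with xy show False by simp
qed

text \<open>Equality in the upper bound makes every estimate in its proof tight. The optimal
  perturbation \<open>Y\<close> then maximizes the ratio of the two norms, and the equality case of
  Minkowski makes \<open>Z\<close> a multiple of \<open>Y\<close>.\<close>

lemma worst_case_eqD:
  fixes Z X :: "real^'n^'m"
  assumes P: "1 < P" and "1 \<le> q" "0 < lam" "X \<noteq> 0"
    and eq: "worst_case (ereal P) q lam Z X
      = entrywise_norm (ereal P) Z + lam * delta (CARD('m) * CARD('n)) (ereal P) 2 * norm X"
  shows "entrywise_norm (ereal P) Z = delta (CARD('m) * CARD('n)) (ereal P) 2 * norm Z"
proof (cases "Z = 0")
  case True
  then show ?thesis using P by (simp add: entrywise_norm_0)
next
  case False
  define d where "d = delta (CARD('m) * CARD('n)) (ereal P) 2"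
  have p: "1 \<le> ereal P" using P by simp
  have d: "d > 0" unfolding d_def using delta_pos[of "ereal P" 2] p by simp
  obtain D where D: "worst_case (ereal P) q lam Z X = entrywise_norm (ereal P) (Z + D X)"
      "norm (D X) \<le> lam * norm X"
    using worst_case_attained[OF p \<open>1 \<le> q\<close>] \<open>0 < lam\<close> by (metis less_imp_le)
  define Y where "Y = D X"
  define z y where "z = entrywise_norm (ereal P) Z" and "y = entrywise_norm (ereal P) Y"
  have "entrywise_norm (ereal P) (Z + Y) \<le> z + y"
    unfolding z_def y_def using entrywise_norm_triangle p by blast
  moreover have "y \<le> d * norm Y"
    using entrywise_norm_le_delta_norm[of "ereal P" Y] p by (simp add: d_def y_def)
  moreover have "d * norm Y \<le> d * (lam * norm X)"
    using D d by (intro mult_left_mono) (auto simp: Y_def)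
  moreover have "entrywise_norm (ereal P) (Z + Y) = z + d * (lam * norm X)"
    using eq D by (simp add: Y_def z_def d_def mult_ac)
  ultimately have y: "y = d * norm Y" "y = d * (lam * norm X)"
    and ZY: "entrywise_norm (ereal P) (Z + Y) = z + y" by linarith+
  \<comment> \<open>Positivity of both norms is what the equality case of Minkowski
    requires.\<close>
  have "y > 0" unfolding y(2) using d \<open>0 < lam\<close> \<open>X \<noteq> 0\<close> by simp
  have "z > 0" using entrywise_norm_pos[OF p False] by (simp add: z_def)
  have "Z $ i $ j / z = Y $ i $ j / y" for i j
    using lp_norm_triangle_eqD[OF P, of UNIV "\<lambda>(i, j). Z $ i $ j" "\<lambda>(i, j). Y $ i $ j" "(i, j)"]
      ZY \<open>y > 0\<close> \<open>z > 0\<close>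
    by (simp add: entrywise_norm_def z_def y_def case_prod_unfold)
  then have "Z = (z / y) *\<^sub>R Y"
    using \<open>y > 0\<close> \<open>z > 0\<close> by (simp add: vec_eq_iff field_simps)
  then have "norm Z = z / y * norm Y"
    using \<open>y > 0\<close> \<open>z > 0\<close> by (metis abs_of_pos divide_pos_pos norm_scaleR)
  then have "d * norm Z = z"
    using y(1) \<open>y > 0\<close> by (auto simp: field_simps)
  then show ?thesis by (simp add: d_def z_def)
qed

text \<open>Two distinct entries exist because there are at least two. Equality in the upper bound
  constrains this pair by \<open>delta_maximizer_critical\<close>, which confines \<open>Z\<close>
  to four hyperplanes.\<close>

lemma AE_worst_case_less:
  fixes X :: "real^'n^'m"
  assumes P: "1 < P" "P \<noteq> 2" and "1 \<le> q" "0 < lam" "X \<noteq> 0"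
    and card: "CARD('m) * CARD('n) \<ge> 2"
  shows "AE Z in lebesgue. worst_case (ereal P) q lam Z X
    < entrywise_norm (ereal P) Z + lam * delta (CARD('m) * CARD('n)) (ereal P) 2 * norm X"
proof -
  have "CARD('m \<times> 'n) \<ge> 2" using card by simp
  then obtain k l :: "'m \<times> 'n" where "k \<noteq> l"
    by (metis card_2_iff' ex_card UNIV_I)
  then obtain a b c d where kl: "((a, b) :: 'm \<times> 'n) \<noteq> (c, d)"
    by (metis surj_pair)
  define u v :: "real^'n^'m" where "u = axis a (axis b 1)" and "v = axis c (axis d 1)"
  have u: "u \<bullet> Z = Z $ a $ b" and v: "v \<bullet> Z = Z $ c $ d" for Z
    by (simp_all add: u_def v_def inner_axis')
  have "u \<bullet> u = 1" "v \<bullet> v = 1" "u \<bullet> v = 0"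
    using kl by (auto simp: u v) (auto simp: u_def v_def axis_def)
  \<comment> \<open>A hyperplane is negligible only if its normal is nonzero; orthonormality of
    \<open>u\<close> and \<open>v\<close> ensures this.\<close>
  then have ne: "u \<noteq> 0" "v \<noteq> 0" "u - v \<noteq> 0" "u + v \<noteq> 0"
    by (auto simp: inner_commute add_eq_0_iff)
  \<comment> \<open>The last two sets split equality of the squares into equality up to
    sign.\<close>
  define N where "N = {Z. u \<bullet> Z = 0} \<union> {Z. v \<bullet> Z = 0} \<union> {Z. (u - v) \<bullet> Z = 0} \<union> {Z. (u + v) \<bullet> Z = 0}"
  have "negligible N"
    unfolding N_def using ne by (intro negligible_Un negligible_hyperplane) auto
  then have N: "N \<in> null_sets lebesgue" by (simp add: negligible_iff_null_sets)
  show ?thesis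
  proof (rule AE_I'[OF N], rule subsetI)
    fix Z assume "Z \<in> {Z \<in> space lebesgue. \<not> worst_case (ereal P) q lam Z X
      < entrywise_norm (ereal P) Z + lam * delta (CARD('m) * CARD('n)) (ereal P) 2 * norm X}"
    then have "worst_case (ereal P) q lam Z X
      = entrywise_norm (ereal P) Z + lam * delta (CARD('m) * CARD('n)) (ereal P) 2 * norm X"
      using worst_case_le[of "ereal P" q lam Z X] assms by simp
    from delta_maximizer_critical[OF P worst_case_eqD[OF P(1) assms(3-5) this] kl]
    show "Z \<in> N" by (auto simp: N_def u v inner_diff_left inner_add_left power2_eq_iff)
  qed
qed

section \<open>Differentiability of the norm and tightness of the lower bound\<close>

text \<open>At zero the difference quotient has absolute value
  \<open>\<bar>h\<bar> powr (P - 1)\<close>, which tends to 0 because \<open>P > 1\<close>;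
  elsewhere the chain rule applies.\<close>

lemma abs_powr_differentiable:
  fixes t :: real
  assumes "1 < P"
  shows "(\<lambda>x. \<bar>x\<bar> powr P) differentiable (at t)"
proof (cases "t = 0")
  case True
  have "((\<lambda>h. \<bar>h\<bar> powr (P - 1)) \<longlongrightarrow> \<bar>0\<bar> powr (P - 1)) (at (0::real))"
    using assms by (intro tendsto_powr' tendsto_intros) auto
  then have "((\<lambda>h. \<bar>h\<bar> powr (P - 1)) \<longlongrightarrow> 0) (at (0::real))" by simp
  then have "((\<lambda>h. \<bar>h\<bar> powr P / h) \<longlongrightarrow> 0) (at (0::real))"
    by (rule Lim_null_comparison[rotated])
       (auto simp: eventually_at_filter powr_diff abs_divide)
  then have "((\<lambda>x. \<bar>x\<bar> powr P) has_real_derivative 0) (at 0)"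
    by (simp add: DERIV_def)
  then show ?thesis
    using True real_differentiable_def by blast
next
  case False
  have "((\<lambda>s. s powr P) has_real_derivative P * \<bar>t\<bar> powr (P - 1)) (at \<bar>t\<bar>)"
    using False by (auto intro!: derivative_eq_intros)
  then have "(\<lambda>s. s powr P) differentiable (at \<bar>t\<bar>)"
    using real_differentiable_def by blast
  moreover have "(\<lambda>x. \<bar>x\<bar>) differentiable (at t)"
  proof -
    have "(norm :: real \<Rightarrow> real) differentiable (at t)"
      using has_derivative_norm[OF False] by (rule differentiableI)
    then show ?thesis by (simp only: real_norm_def[abs_def])
  qed
  ultimately show ?thesis
    by (rule differentiable_compose)
qed

text \<open>The sum of powers is differentiable and, as \<open>A \<noteq> 0\<close>, positive at
  \<open>A\<close>, where the root is differentiable too.\<close>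

lemma entrywise_norm_differentiable:
  fixes A :: "real^'n^'m"
  assumes "1 < P" "A \<noteq> 0"
  shows "entrywise_norm (ereal P) differentiable (at A)"
proof -
  define F where "F B = (\<Sum>r\<in>UNIV. \<bar>B $ fst r $ snd r\<bar> powr P)" for B :: "real^'n^'m"
  have "F A = entrywise_norm (ereal P) A powr P"
    using assms by (simp add: F_def entrywise_norm_powr)
  then have "F A > 0"
    using entrywise_norm_pos[of "ereal P" A] assms by simp
  have "linear (\<lambda>B :: real^'n^'m. B $ i $ j)" for i j
    by (rule linearI) simp_all
  then have "(\<lambda>B :: real^'n^'m. B $ i $ j) differentiable (at A)" for i j
    using linear_imp_differentiable by blast
  then have "(\<lambda>B :: real^'n^'m. \<bar>B $ i $ j\<bar> powr P) differentiable (at A)" for i j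
    using differentiable_compose[OF abs_powr_differentiable[OF assms(1)]] by blast
  then have F: "F differentiable (at A)"
    unfolding F_def by (intro differentiable_sum ballI) auto
  have "((\<lambda>s. s powr (1 / P)) has_real_derivative 1 / P * F A powr (1 / P - 1)) (at (F A))"
    using \<open>F A > 0\<close> by (auto intro!: derivative_eq_intros)
  then have "(\<lambda>s. s powr (1 / P)) differentiable (at (F A))"
    using real_differentiable_def by blast
  then have "(\<lambda>B. F B powr (1 / P)) differentiable (at A)"
    using F by (rule differentiable_compose)
  moreover have "(\<lambda>B. F B powr (1 / P)) = entrywise_norm (ereal P)"
    by (simp add: fun_eq_iff F_def entrywise_norm_def lp_norm_ereal case_prod_unfold)
  ultimately show ?thesis by simp
qed

text \<open>At a minimizer \<open>A\<close> of the \<open>p\<close>-norm on a Euclidean sphere, the \<open>p\<close>-norm and the multiple of the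
  Euclidean norm below it touch, so they have the same derivative; far out on the ray through \<open>A\<close>
  the \<open>p\<close>-norm is therefore nearly linear with a gradient of Euclidean length \<open>1 / delta\<close>.\<close>

lemma worst_case_gap_small:
  fixes X :: "real^'n^'m"
  assumes P: "1 < P" and "1 \<le> q" "0 \<le> lam" "0 < e"
  shows "\<exists>Z. worst_case (ereal P) q lam Z X
    \<le> entrywise_norm (ereal P) Z + lam / delta (CARD('m) * CARD('n)) 2 (ereal P) * norm X + e"
proof -
  define d where "d = delta (CARD('m) * CARD('n)) 2 (ereal P)"
  define f where "f = (entrywise_norm (ereal P) :: real^'n^'m \<Rightarrow> real)"
  define r where "r = lam * norm X"
  have p: "1 \<le> ereal P" using P by simp
  have r: "r \<ge> 0" using assms by (simp add: r_def)
  have d: "d > 0" unfolding d_def using delta_pos[of 2 "ereal P"] p by simp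
  \<comment> \<open>A maximizer for \<open>delta\<close> at \<open>p\<close>-norm 1 is, up to
    scaling, a minimizer of the \<open>p\<close>-norm on a Euclidean sphere.\<close>
  obtain A :: "real^'n^'m" where A: "f A = 1" "norm A = d"
    using delta_attained[of 2 "ereal P"] p unfolding f_def d_def entrywise_norm_2 by auto
  then have "A \<noteq> 0" using d by auto
  have le: "norm B / d \<le> f B" for B
    using norm_le_delta[of "ereal P" B] p d
    by (simp add: d_def f_def field_simps)
  obtain f' where f': "(f has_derivative f') (at A)"
    using entrywise_norm_differentiable[OF P \<open>A \<noteq> 0\<close>] by (auto simp: differentiable_def f_def)
  have "((\<lambda>B. f B - norm B / d) has_derivative (\<lambda>h. f' h - (h \<bullet> sgn A) / d)) (at A)"
    by (intro has_derivative_diff f' bounded_linear.has_derivative[OF bounded_linear_divide]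
        has_derivative_norm \<open>A \<noteq> 0\<close>)
  moreover have "\<forall>B\<in>UNIV. f A - norm A / d \<le> f B - norm B / d"
    using le A d by simp
  ultimately have "(\<lambda>h. f' h - (h \<bullet> sgn A) / d) = (\<lambda>h. 0)"
    by (intro differential_zero_maxmin[OF UNIV_I open_UNIV]) auto
  then have f'_eq: "f' h = (h \<bullet> sgn A) / d" for h
    by (metis eq_iff_diff_eq_0)
  have f'_le: "f' h \<le> norm h / d" for h
    using norm_cauchy_schwarz[of h "sgn A"] \<open>A \<noteq> 0\<close> d
    by (simp add: f'_eq norm_sgn divide_right_mono)
  \<comment> \<open>The linearization error, after scaling back by \<open>t\<close>, is at most
    \<open>e' * r\<close>, hence at most \<open>e\<close>; adding 1 avoids division by zero when
    \<open>r = 0\<close>.\<close>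
  define e' where "e' = e / (r + 1)"
  have "e' > 0" using assms r by (simp add: e'_def)
  then obtain \<eta> where \<eta>: "\<eta> > 0"
    "\<And>B. norm (B - A) < \<eta> \<Longrightarrow> norm (f B - f A - f' (B - A)) \<le> e' * norm (B - A)"
    using f' unfolding has_derivative_at_alt by blast
  \<comment> \<open>Far enough out on the ray that the rescaled perturbation \<open>h\<close> is
    shorter than \<open>\<eta>\<close>.\<close>
  define t where "t = (r + 1) / \<eta>"
  have t: "t > 0" using \<eta> r by (simp add: t_def)
  obtain D where D: "worst_case (ereal P) q lam (t *\<^sub>R A) X = f (t *\<^sub>R A + D X)"
      "norm (D X) \<le> r"
    using worst_case_attained[OF p assms(2,3)] by (metis f_def r_def)
  define h where "h = (1 / t) *\<^sub>R D X"
  have th: "t * norm h = norm (D X)" using t by (simp add: h_def)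
  have "t * norm h < t * \<eta>" using th D \<eta> r by (simp add: t_def)
  then have "norm h < \<eta>" using t by simp
  then have "f (A + h) \<le> 1 + norm h / d + e' * norm h"
    using \<eta>(2)[of "A + h"] f'_le[of h] A by simp
  then have "t * f (A + h) \<le> t * (1 + norm h / d + e' * norm h)"
    using t by simp
  also have "\<dots> = t + norm (D X) / d + e' * norm (D X)"
    by (simp add: distrib_left flip: th)
  also have "\<dots> \<le> t + r / d + e' * (r + 1)"
    using D d \<open>e' > 0\<close> by (intro add_mono mult_left_mono divide_right_mono) auto
  also have "e' * (r + 1) = e" using r by (simp add: e'_def)
  finally have "t * f (A + h) \<le> t + r / d + e" .
  moreover have "t *\<^sub>R A + D X = t *\<^sub>R (A + h)"
    using t by (simp add: h_def scaleR_right_distrib)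
  moreover have "f (t *\<^sub>R B) = t * f B" for B
    using t by (simp add: f_def entrywise_norm_scaleR[OF p])
  ultimately have "worst_case (ereal P) q lam (t *\<^sub>R A) X \<le> f (t *\<^sub>R A) + r / d + e"
    using D A by simp
  then show ?thesis by (auto simp: f_def r_def d_def)
qed

theorem proposition11:
  fixes lam :: real and p q :: ereal
  assumes "lam > 0" and "1 \<le> p" and "1 \<le> q"
  shows
    "(\<forall>Z X :: real^'n^'m.
        (\<exists>D\<in>uncertainty_set q lam. \<forall>D'\<in>uncertainty_set q lam.
            entrywise_norm p (Z + D' X) \<le> entrywise_norm p (Z + D X))
        \<and> entrywise_norm p Z + lam / delta (CARD('m) * CARD('n)) 2 p * entrywise_norm 2 X
            \<le> worst_case p q lam Z X
        \<and> worst_case p q lam Z X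
            \<le> entrywise_norm p Z + lam * delta (CARD('m) * CARD('n)) p 2 * entrywise_norm 2 X)
     \<and> (p \<notin> {1, 2, \<infinity>} \<and> CARD('m) * CARD('n) \<ge> 2 \<longrightarrow>
        (\<forall>X :: real^'n^'m. X \<noteq> 0 \<longrightarrow>
          (AE Z in lebesgue. worst_case p q lam Z X
             < entrywise_norm p Z + lam * delta (CARD('m) * CARD('n)) p 2 * entrywise_norm 2 X)))
     \<and> (p \<notin> {1, 2, \<infinity>} \<longrightarrow>
        (\<forall>X :: real^'n^'m.
          (INF Z. worst_case p q lam Z X
             - (entrywise_norm p Z + lam / delta (CARD('m) * CARD('n)) 2 p * entrywise_norm 2 X)) = 0))"
proof -
  have lam: "0 \<le> lam" using assms by simp
  have P: "\<exists>P. p = ereal P \<and> 1 < P \<and> P \<noteq> 2" if "p \<notin> {1, 2, \<infinity>}"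
    using assms(2) that by (cases p) (auto simp: one_ereal_def order_le_less)
  have "\<exists>D\<in>uncertainty_set q lam. \<forall>D'\<in>uncertainty_set q lam.
      entrywise_norm p (Z + D' X) \<le> entrywise_norm p (Z + D X)" for Z X :: "real^'n^'m"
    using worst_case_attained[OF assms(2,3) lam, of Z X] uncertainty_set_norm_le[OF _ assms(3)]
    by metis
  moreover have "(INF Z. worst_case p q lam Z X
      - (entrywise_norm p Z + lam / delta (CARD('m) * CARD('n)) 2 p * norm X)) = 0"
    if "p \<notin> {1, 2, \<infinity>}" for X :: "real^'n^'m"
  proof -
    define g where "g Z = worst_case p q lam Z X
      - (entrywise_norm p Z + lam / delta (CARD('m) * CARD('n)) 2 p * norm X)" for Z
    have nonneg: "0 \<le> g Z" for Z
      using worst_case_ge[OF assms(2,3) lam, of Z X] by (simp add: g_def)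
    then have "0 \<le> (INF Z. g Z)" by (intro cINF_greatest) auto
    \<comment> \<open>On the reals \<open>INF\<close> is below each value only for a function
      bounded below, which \<open>nonneg\<close> supplies.\<close>
    moreover have "(INF Z. g Z) \<le> 0 + e" if "e > 0" for e
    proof -
      obtain Z where "g Z \<le> e"
        using P[OF \<open>p \<notin> {1, 2, \<infinity>}\<close>] worst_case_gap_small[OF _ assms(3) lam \<open>e > 0\<close>, of _ X]
        by (fastforce simp: g_def algebra_simps)
      then show ?thesis
        using nonneg by (intro cINF_lower2[where x = Z]) (auto intro!: bdd_belowI[of _ 0])
    qed
    then have "(INF Z. g Z) \<le> 0" by (rule field_le_epsilon)
    ultimately show ?thesis unfolding g_def by (rule antisym[rotated])
  qed
  ultimately show ?thesis
    unfolding entrywise_norm_2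
    using worst_case_ge[OF assms(2,3) lam] worst_case_le[OF assms(2,3) lam]
      AE_worst_case_less[OF _ _ assms(3,1)] P
    by blast
qed

end
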